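(* Let $x\in\mathcal F$ be fixed and write $\mu=\mu(x)$. Assume: (a) $K$ is a nonnegative bounded kernel of class $\mathcal C^1$ over its support $[0,1]$ such that $K(1)>0$; the derivative $K'$ exists on $[0,1]$ and satisfies $K'(t)<0$ for all $t\in[0,1]$; and $\left|\int_0^1 (K^j)'(t)\,dt\right|<\infty$ for $j=1,2$. (b) There exist a deterministic nonnegative bounded function $g$ and a nonnegative real function $\phi$, tending to $0$ as its argument tends to $0$, such that (i) $F_x(h):=\mathbb P(X\in\mathcal B(x,h))=\phi(h)\,g(x)+o(\phi(h))$ as $h\to0$; (ii) there exists a nondecreasing bounded function $\tau_0$ such that, uniformly in $s\in[0,1]$, $\phi(hs)/\phi(h)=\tau_0(s)+o(1)$ as $h\downarrow0$ and, for $j\ge1$, $\int_0^1 (K^j(t))'\tau_0(t)\,dt<\infty$. (c) $\mathbb E[\mathcal U(Y-\mu)\mid d(x,X)=v]=:\psi(v)$ for $v\in\mathbb R$, where $\psi:\mathbb R\to\mathbb R^d$ is a differentiable function such that $\nabla\psi(0)\neq0$. (d) $g(x)>0$ and $\left|\int_0^1 (sK(s))'\tau_0(s)\,ds\right|<\infty$. Then $$\mathcal B_n(x)=\frac{h\,[H^x(\mu)]^{-1}\,\nabla\psi(0)}{M_1}\left[\int_0^1(sK(s))'\,\tau_0(s)\,ds-K(1)+o_{a.s.}(1)\right],$$ where, for $j=1,2$, $M_j=K^j(1)-\int_0^1(K^j)'(z)\,\tau_0(z)\,dz$.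
   Context: $(X,Y)$ is a random pair on a probability space; $Y$ takes values in $\mathbb R^d$ ($d\ge2$) with $\mathbb E\|Y\|<\infty$; $X$ takes values in an infinite-dimensional vector space $\mathcal F$ equipped with a semi-metric $d(\cdot,\cdot)$. $\mathcal B(x,h)=\{x'\in\mathcal F: d(x,x')\le h\}$. $(X_i,Y_i)_{i=1,\dots,n}$ are i.i.d. copies of $(X,Y)$, and $h=h_n$ is a sequence of positive real numbers decreasing to $0$ as $n\to\infty$. $G^x(u)=\mathbb E[\|Y-u\|\mid X=x]$ is assumed differentiable and uniformly bounded with respect to $u$; $\mu(x)=\arg\min_{u\in\mathbb R^d}G^x(u)$ is the conditional $L_1$-median of $Y$ given $X=x$, which exists and is unique when the conditional distribution of $Y$ given $X=x$ is not supported on a single straight line, as is assumed. $\mathcal U(y)=y/\|y\|$ for $y\ne0$ and $\mathcal U(0)=0$; for $y\ne u$, $\mathcal M(y,u)=\|y-u\|^{-1}\left(\mathbf I_d-\mathcal U(y-u)\,\mathcal U^t(y-u)\right)$, with $\mathbf I_d$ the $d\times d$ identity matrix; $H^x(u)=\mathbb E[\mathcal M(Y,u)\mid X=x]$ is the Hessian of $G^x$ at $u$, and $H^x(\mu)$ and its inverse are taken to exist. By definition of $\mu$, $\psi(0)=\mathbb E[\mathcal U(Y-\mu)\mid X=x]=0$. With $\Delta_i(x)=K(d(x,X_i)/h)$, $$\nabla_u\widetilde G_n^x(u)=-\frac{\sum_{i=1}^n\mathcal U(Y_i-u)\,\Delta_i(x)}{n\,\mathbb E(\Delta_1(x))},\qquad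 \widetilde{\mathcal B}_n(x)=\mathbb E\left[\nabla_u\widetilde G_n^x(\mu)\right],$$ and the conditional bias term is $\mathcal B_n(x)=-[H^x(\mu)]^{-1}\,\widetilde{\mathcal B}_n(x)$.
   Formalization: The printed sign is wrong for the given definitions: the formal right-hand side carries an extra overall minus sign; and the o_{a.s.}(1) term is vector-valued, added to the bracket times [H^x(μ)]^{-1}∇ψ(0), since a scalar remainder fails in general. *)

theory Defs
  imports "HOL-Probability.Probability"
begin

text \<open>
  The map \<open>\<U>(y) = y / \<parallel>y\<parallel>\<close>, \<open>\<U>(0) = 0\<close> is the library function \<^const>\<open>sgn\<close> on a real
  normed vector space.
\<close>

definition infinite_dimensional :: "'f::real_vector itself \<Rightarrow> bool" where
  "infinite_dimensional _ \<longleftrightarrow> (\<nexists>B :: 'f set. finite B \<and> span B = UNIV)"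

definition semi_metric :: "('f \<Rightarrow> 'f \<Rightarrow> real) \<Rightarrow> bool" where
  "semi_metric d \<longleftrightarrow>
     (\<forall>x y. 0 \<le> d x y) \<and> (\<forall>x. d x x = 0) \<and> (\<forall>x y. d x y = d y x) \<and>
     (\<forall>x y z. d x z \<le> d x y + d y z)"

definition semi_ball :: "('f \<Rightarrow> 'f \<Rightarrow> real) \<Rightarrow> 'f \<Rightarrow> real \<Rightarrow> 'f set" where
  "semi_ball d x h = {x'. d x x' \<le> h}"

text \<open>
  \<open>\<kappa>\<close> is a regular version of the conditional distribution of \<open>Y\<close> given \<open>X\<close>.  A fixed version is
  needed to speak about \<open>E[\<cdot> | X = x]\<close> at a single point \<open>x\<close>, which may have probability zero.
\<close>

definition regular_cond_distr ::
  "'w measure \<Rightarrow> 'f measure \<Rightarrow> ('w \<Rightarrow> 'f) \<Rightarrow> ('w \<Rightarrow> 'y::topological_space) \<Rightarrow> ('f \<Rightarrow> 'y measure) \<Rightarrow> bool"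
where
  "regular_cond_distr M N X Y \<kappa> \<longleftrightarrow>
     \<kappa> \<in> N \<rightarrow>\<^sub>M prob_algebra borel \<and>
     (\<forall>A\<in>sets N. \<forall>B\<in>sets borel.
        emeasure M {\<omega>\<in>space M. X \<omega> \<in> A \<and> Y \<omega> \<in> B} =
          (\<integral>\<^sup>+x\<in>A. emeasure (\<kappa> x) B \<partial>distr M N X))"

text \<open>
  \<open>\<psi>\<close> is a version of \<open>v \<mapsto> E[Z | V = v]\<close> for a real random variable \<open>V\<close> and a random vector \<open>Z\<close>
  (the library's conditional expectation is real-valued, hence the components).
\<close>

definition cond_exp_given ::
  "'w measure \<Rightarrow> ('w \<Rightarrow> real) \<Rightarrow> ('w \<Rightarrow> real^'n) \<Rightarrow> (real \<Rightarrow> real^'n) \<Rightarrow> bool"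
where
  "cond_exp_given M V Z \<psi> \<longleftrightarrow>
     \<psi> \<in> borel_measurable borel \<and>
     (\<forall>i. AE \<omega> in M.
        real_cond_exp M (vimage_algebra (space M) V borel) (\<lambda>\<omega>'. Z \<omega>' $ i) \<omega> = \<psi> (V \<omega>) $ i)"

text \<open>In the following, \<open>\<nu>\<close> stands for the conditional distribution of \<open>Y\<close> given \<open>X = x\<close>.\<close>

definition L1_criterion :: "(real^'n) measure \<Rightarrow> real^'n \<Rightarrow> real" where
  "L1_criterion \<nu> u = (\<integral>y. norm (y - u) \<partial>\<nu>)"

definition is_L1_median :: "(real^'n) measure \<Rightarrow> real^'n \<Rightarrow> bool" where
  "is_L1_median \<nu> u \<longleftrightarrow> is_arg_min (L1_criterion \<nu>) (\<lambda>_. True) u"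

definition supported_on_line :: "(real^'n) measure \<Rightarrow> bool" where
  "supported_on_line \<nu> \<longleftrightarrow> (\<exists>L. collinear L \<and> (AE y in \<nu>. y \<in> L))"

text \<open>For \<open>y = u\<close> the value below is \<open>0\<close>.\<close>

definition hess_integrand :: "real^'n \<Rightarrow> real^'n \<Rightarrow> real^'n^'n" where
  "hess_integrand y u =
     (1 / norm (y - u)) *\<^sub>R (mat 1 - (\<chi> i j. sgn (y - u) $ i * sgn (y - u) $ j))"

definition L1_hessian :: "(real^'n) measure \<Rightarrow> real^'n \<Rightarrow> real^'n^'n" where
  "L1_hessian \<nu> u = (\<integral>y. hess_integrand y u \<partial>\<nu>)"

text \<open>
  Derivatives of functions of the kernel are taken within \<open>[0,1]\<close> (one-sided at the end points):
  the kernel vanishes outside of \<open>[0,1]\<close> and jumps at \<open>1\<close>.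
\<close>

definition deriv01 :: "(real \<Rightarrow> real) \<Rightarrow> real \<Rightarrow> real" where
  "deriv01 f t = vector_derivative f (at t within {0..1})"

definition kernel_const :: "(real \<Rightarrow> real) \<Rightarrow> (real \<Rightarrow> real) \<Rightarrow> nat \<Rightarrow> real" where
  "kernel_const K \<tau>0 j =
     K 1 ^ j - (LBINT z:{0..1}. deriv01 (\<lambda>t. K t ^ j) z * \<tau>0 z)"

definition kernel_weight ::
  "('f \<Rightarrow> 'f \<Rightarrow> real) \<Rightarrow> (real \<Rightarrow> real) \<Rightarrow> real \<Rightarrow> 'f \<Rightarrow> 'f \<Rightarrow> real"
where
  "kernel_weight d K h x x' = K (d x x' / h)"

text \<open>\<open>\<nabla>\<^sub>u G\<^sub>n\<^sup>x(u)\<close>, with sample \<open>(Xs i, Ys i)\<close> for \<open>i = 1, \<dots>, n\<close> and bandwidth \<open>h\<close>.\<close>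

definition grad_est ::
  "'w measure \<Rightarrow> ('f \<Rightarrow> 'f \<Rightarrow> real) \<Rightarrow> (real \<Rightarrow> real) \<Rightarrow> real \<Rightarrow> (nat \<Rightarrow> 'w \<Rightarrow> 'f) \<Rightarrow>
    (nat \<Rightarrow> 'w \<Rightarrow> real^'n) \<Rightarrow> 'f \<Rightarrow> nat \<Rightarrow> real^'n \<Rightarrow> 'w \<Rightarrow> real^'n"
where
  "grad_est M d K h Xs Ys x n u \<omega> =
     - ((\<Sum>i=1..n. kernel_weight d K h x (Xs i \<omega>) *\<^sub>R sgn (Ys i \<omega> - u)) /\<^sub>R
        (real n * (\<integral>\<omega>'. kernel_weight d K h x (Xs 1 \<omega>') \<partial>M)))"

definition grad_bias ::
  "'w measure \<Rightarrow> ('f \<Rightarrow> 'f \<Rightarrow> real) \<Rightarrow> (real \<Rightarrow> real) \<Rightarrow> real \<Rightarrow> (nat \<Rightarrow> 'w \<Rightarrow> 'f) \<Rightarrow>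
    (nat \<Rightarrow> 'w \<Rightarrow> real^'n) \<Rightarrow> 'f \<Rightarrow> nat \<Rightarrow> real^'n \<Rightarrow> real^'n"
where
  "grad_bias M d K h Xs Ys x n \<mu> = (\<integral>\<omega>. grad_est M d K h Xs Ys x n \<mu> \<omega> \<partial>M)"

text \<open>
  Sign of the expansion: the gradient has the factor \<open>-1\<close> and so has the conditional bias below; hence
  \<open>\<B>\<^sub>n = [H\<^sup>x(\<mu>)]\<^sup>-\<^sup>1 E[\<U>(Y - \<mu>) \<Delta>\<^sub>1] / E[\<Delta>\<^sub>1]\<close>, whose leading coefficient
  \<open>K(1) - \<integral>\<^sub>0\<^sup>1 (sK(s))' \<tau>\<^sub>0(s) ds\<close> (the limit of \<open>E[(d(x,X)/h) \<Delta>\<^sub>1] / (\<phi>(h) g(x))\<close>) is nonnegative.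
  The formula printed in the source has the bracket \<open>\<integral>\<^sub>0\<^sup>1 (sK(s))' \<tau>\<^sub>0(s) ds - K(1)\<close> without the
  minus sign in front that these definitions require.
\<close>

definition cond_bias ::
  "'w measure \<Rightarrow> ('f \<Rightarrow> 'f \<Rightarrow> real) \<Rightarrow> (real \<Rightarrow> real) \<Rightarrow> real \<Rightarrow> (nat \<Rightarrow> 'w \<Rightarrow> 'f) \<Rightarrow>
    (nat \<Rightarrow> 'w \<Rightarrow> real^'n) \<Rightarrow> 'f \<Rightarrow> (real^'n) measure \<Rightarrow> nat \<Rightarrow> real^'n \<Rightarrow> real^'n"
where
  "cond_bias M d K h Xs Ys x \<nu> n \<mu> =
     - (matrix_inv (L1_hessian \<nu> \<mu>) *v grad_bias M d K h Xs Ys x n \<mu>)"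

text \<open>
  \<open>\<epsilon>\<^sub>n = o\<^sub>a\<^sub>.\<^sub>s\<^sub>.(1)\<close> for random vectors.  The remainder of the bias expansion is vector-valued: the
  first-order remainder of \<open>\<psi>\<close> at \<open>0\<close> need not be a multiple of \<open>\<nabla>\<psi>(0)\<close>, so a scalar remainder
  cannot be had.
\<close>

definition small_o_as :: "'w measure \<Rightarrow> (nat \<Rightarrow> 'w \<Rightarrow> 'v::real_normed_vector) \<Rightarrow> bool" where
  "small_o_as M \<epsilon> \<longleftrightarrow>
     (\<forall>n. \<epsilon> n \<in> borel_measurable M) \<and> (AE \<omega> in M. (\<lambda>n. \<epsilon> n \<omega>) \<longlonglongrightarrow> 0)"

end

theory Submission
  imports Defs
begin

text \<open>
  Since \<open>\<mu>\<close> minimises the differentiable criterion, symmetric difference quotients give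
  \<open>E[\<U>(Y - \<mu>) | X = x] = 0\<close>, that is \<open>\<psi> 0 = 0\<close>.  Put \<open>V = d(x, X)\<close>.  Identical distribution
  and conditioning on \<open>V\<close> turn the bias of the gradient into \<open>- E[K(V/h) \<psi>(V)] / E[K(V/h)]\<close>.  As
  \<open>K(V/h)\<close> vanishes for \<open>V > h\<close>, the first-order expansion of \<open>\<psi>\<close> at \<open>0\<close> reduces everything to
  the limit of \<open>E[(V/h) K(V/h)] / E[K(V/h)]\<close>.  Both expectations are of the form
  \<open>E[f(V/h) 1(V \<le> h)] = f(1) F(h) - \<integral>\<^sub>0\<^sup>1 f'(s) F(hs) ds\<close> with \<open>F(r) = P(V \<le> r)\<close>, by Fubini's
  theorem; divided by \<open>\<phi>(h)\<close> they converge to \<open>g(x) (f(1) - \<integral>\<^sub>0\<^sup>1 f'(s) \<tau>\<^sub>0(s) ds)\<close> by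
  dominated convergence, because \<open>F(hs) \<le> F(h)\<close>.
\<close>

section \<open>Stationarity of the conditional median\<close>

text \<open>Away from 0 the norm is differentiable with gradient \<open>sgn z\<close>; at
  \<open>z = 0\<close> the two norms cancel exactly, in agreement with \<open>sgn 0 = 0\<close>. A
  one-sided quotient would leave a multiple of \<open>norm v\<close> there, so the symmetric form is
  what copes with an atom of the conditional law at its median.\<close>

lemma norm_symmetric_difference_tendsto:
  fixes z v :: "'a::real_inner"
  assumes t: "t \<longlonglongrightarrow> 0" and t_ne: "\<And>n. t n \<noteq> (0::real)"
  shows "(\<lambda>n. (norm (z - t n *\<^sub>R v) - norm (z + t n *\<^sub>R v)) / t n) \<longlonglongrightarrow> - 2 * (sgn z \<bullet> v)"
proof (cases "z = 0")
  case True
  then show ?thesis by simp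
next
  case False
  have D: "((\<lambda>s. norm (z + s *\<^sub>R w)) has_real_derivative sgn z \<bullet> w) (at 0)" for w
  proof -
    have "((\<lambda>s. z + s *\<^sub>R w) has_derivative (\<lambda>s. s *\<^sub>R w)) (at 0)"
      by (auto intro!: derivative_eq_intros)
    moreover have "(norm has_derivative (\<lambda>h. h \<bullet> sgn z)) (at (z + 0 *\<^sub>R w))"
      using has_derivative_norm[OF False] by simp
    ultimately have "((norm \<circ> (\<lambda>s. z + s *\<^sub>R w)) has_derivative ((\<lambda>h. h \<bullet> sgn z) \<circ> (\<lambda>s. s *\<^sub>R w))) (at 0)"
      by (rule diff_chain_at)
    then show ?thesis
      by (simp add: has_field_derivative_def o_def mult_commute_abs inner_commute)
  qed
  have "((\<lambda>s. norm (z + s *\<^sub>R (- v)) - norm (z + s *\<^sub>R v)) has_real_derivative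
          sgn z \<bullet> (- v) - sgn z \<bullet> v) (at 0)"
    by (intro DERIV_diff D)
  then have "(\<lambda>s. (norm (z - s *\<^sub>R v) - norm (z + s *\<^sub>R v)) / s) \<midarrow>0\<rightarrow> - 2 * (sgn z \<bullet> v)"
    by (simp add: DERIV_def inner_minus_right)
  moreover have "filterlim t (at 0) sequentially"
    using t t_ne by (auto simp: filterlim_at)
  ultimately show ?thesis
    by (rule filterlim_compose)
qed

text \<open>The derivative of the criterion vanishes at the minimiser, so its symmetric difference
  quotients along \<open>v\<close> tend to 0. The same quotients are integrals of symmetric
  quotients of the norm and converge, under the integral, to \<open>-2\<close> times the inner
  product of the mean of \<open>sgn (y - \<mu>)\<close> with \<open>v\<close>. Comparing the two
  limits for every \<open>v\<close> gives the claim.\<close>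

lemma L1_median_mean_sgn_eq_0:
  fixes \<nu> :: "(real^'n) measure"
  assumes "prob_space \<nu>" and sets_\<nu>: "sets \<nu> = sets borel"
    and int: "integrable \<nu> norm"
    and diff: "L1_criterion \<nu> differentiable (at \<mu>)" and median: "is_L1_median \<nu> \<mu>"
  shows "(\<integral>y. sgn (y - \<mu>) \<partial>\<nu>) = 0"
proof -
  interpret prob_space \<nu> by fact
  have meas: "f \<in> borel_measurable borel \<Longrightarrow> f \<in> borel_measurable \<nu>" for f :: "real^'n \<Rightarrow> 'b::topological_space"
    using sets_\<nu> by (simp cong: measurable_cong_sets)
  have int_norm: "integrable \<nu> (\<lambda>y. norm (y - u))" for u
  proof (rule Bochner_Integration.integrable_bound)
    show "integrable \<nu> (\<lambda>y. norm y + norm u)"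
      using int by simp
    show "AE y in \<nu>. norm (norm (y - u)) \<le> norm (norm y + norm u)"
      by (auto intro: norm_triangle_ineq4)
  qed (auto intro: meas)
  have int_sgn: "integrable \<nu> (\<lambda>y. sgn (y - \<mu>))"
    by (rule integrable_const_bound[where B = 1]) (auto intro: meas simp: norm_sgn)
  have min: "L1_criterion \<nu> \<mu> \<le> L1_criterion \<nu> u" for u
    using median by (force simp: is_L1_median_def is_arg_min_def not_less)
  obtain D where D: "(L1_criterion \<nu> has_derivative D) (at \<mu>)"
    using diff by (auto simp: differentiable_def)
  have D0: "D = (\<lambda>_. 0)"
    by (rule differential_zero_maxmin[OF _ open_UNIV D]) (use min in auto)
  define t :: "nat \<Rightarrow> real" where "t n = inverse (Suc n)" for n
  have t0: "t \<longlonglongrightarrow> 0" unfolding t_def by (rule LIMSEQ_inverse_real_of_nat)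
  have t_pos: "t n > 0" for n by (simp add: t_def)
  have t_ne: "t n \<noteq> 0" for n using t_pos[of n] by simp
  have "(\<integral>y. sgn (y - \<mu>) \<partial>\<nu>) \<bullet> v = 0" for v
  proof -
    \<comment> \<open>As \<open>y - \<mu> - t n *\<^sub>R v\<close> is
      \<open>y - (\<mu> + t n *\<^sub>R v)\<close>, the integral of \<open>q n\<close> is the
      symmetric difference quotient of the criterion at \<mu> in direction \<open>v\<close>.\<close>
    define q where "q n y = (norm (y - \<mu> - t n *\<^sub>R v) - norm (y - \<mu> + t n *\<^sub>R v)) / t n" for n y
    have "(\<lambda>n. \<integral>y. q n y \<partial>\<nu>) \<longlonglongrightarrow> (\<integral>y. - 2 * (sgn (y - \<mu>) \<bullet> v) \<partial>\<nu>)"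
    proof (rule integral_dominated_convergence[where w = "\<lambda>_. 2 * norm v"])
      show "AE y in \<nu>. (\<lambda>n. q n y) \<longlonglongrightarrow> - 2 * (sgn (y - \<mu>) \<bullet> v)"
        unfolding q_def
        by (intro always_eventually allI norm_symmetric_difference_tendsto t0 t_ne)
      \<comment> \<open>The norm is 1-Lipschitz and the two points are
        \<open>2 * t n * norm v\<close> apart; dividing by \<open>t n\<close> leaves a bound free of
        \<open>n\<close> and \<open>y\<close>.\<close>
      show "AE y in \<nu>. norm (q n y) \<le> 2 * norm v" for n
      proof (intro always_eventually allI)
        fix y
        have "\<bar>norm (y - \<mu> - t n *\<^sub>R v) - norm (y - \<mu> + t n *\<^sub>R v)\<bar>
            \<le> norm ((y - \<mu> - t n *\<^sub>R v) - (y - \<mu> + t n *\<^sub>R v))"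
          by (rule norm_triangle_ineq3)
        also have "(y - \<mu> - t n *\<^sub>R v) - (y - \<mu> + t n *\<^sub>R v) = (- 2 * t n) *\<^sub>R v"
          by (simp add: algebra_simps scaleR_2 flip: scaleR_scaleR)
        finally show "norm (q n y) \<le> 2 * norm v"
          using t_pos[of n] by (simp add: q_def divide_simps mult_ac)
      qed
      show "(\<lambda>y. - 2 * (sgn (y - \<mu>) \<bullet> v)) \<in> borel_measurable \<nu>"
        by (intro meas) measurable
      show "q n \<in> borel_measurable \<nu>" for n
        unfolding q_def by (intro meas) measurable
    qed simp
    moreover have "(\<integral>y. - 2 * (sgn (y - \<mu>) \<bullet> v) \<partial>\<nu>) = - 2 * ((\<integral>y. sgn (y - \<mu>) \<partial>\<nu>) \<bullet> v)"
      using int_sgn by simp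
    moreover have "(\<lambda>n. \<integral>y. q n y \<partial>\<nu>) \<longlonglongrightarrow> 0"
    proof -
      have line: "((\<lambda>s. L1_criterion \<nu> (\<mu> + s *\<^sub>R w)) has_real_derivative 0) (at 0)" for w
      proof -
        have "((\<lambda>s. \<mu> + s *\<^sub>R w) has_derivative (\<lambda>s. s *\<^sub>R w)) (at 0)"
          by (auto intro!: derivative_eq_intros)
        moreover have "(L1_criterion \<nu> has_derivative (\<lambda>_. 0)) (at (\<mu> + 0 *\<^sub>R w))"
          using D unfolding D0 by simp
        ultimately have "((L1_criterion \<nu> \<circ> (\<lambda>s. \<mu> + s *\<^sub>R w)) has_derivative ((\<lambda>_. 0) \<circ> (\<lambda>s. s *\<^sub>R w))) (at 0)"
          by (rule diff_chain_at)
        moreover have "(*) (0::real) = (\<lambda>_. 0)"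
          by auto
        ultimately show ?thesis
          by (simp add: has_field_derivative_def o_def)
      qed
      have "((\<lambda>s. L1_criterion \<nu> (\<mu> + s *\<^sub>R v) - L1_criterion \<nu> (\<mu> + s *\<^sub>R (- v)))
          has_real_derivative 0 - 0) (at 0)"
        by (intro DERIV_diff line)
      then have "(\<lambda>s. (L1_criterion \<nu> (\<mu> + s *\<^sub>R v) - L1_criterion \<nu> (\<mu> - s *\<^sub>R v)) / s) \<midarrow>0\<rightarrow> 0"
        by (simp add: DERIV_def)
      moreover have "filterlim t (at 0) sequentially"
        using t0 t_ne by (simp add: filterlim_at)
      ultimately have "(\<lambda>n. (L1_criterion \<nu> (\<mu> + t n *\<^sub>R v) - L1_criterion \<nu> (\<mu> - t n *\<^sub>R v)) / t n)
          \<longlonglongrightarrow> 0"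
        by (rule filterlim_compose)
      moreover have "(\<integral>y. q n y \<partial>\<nu>) =
          (L1_criterion \<nu> (\<mu> + t n *\<^sub>R v) - L1_criterion \<nu> (\<mu> - t n *\<^sub>R v)) / t n" for n
        using int_norm[of "\<mu> + t n *\<^sub>R v"] int_norm[of "\<mu> - t n *\<^sub>R v"]
        by (simp add: q_def L1_criterion_def diff_diff_eq diff_diff_eq2 diff_add_eq)
      ultimately show ?thesis by simp
    qed
    ultimately show ?thesis
      using LIMSEQ_unique by fastforce
  qed
  \<comment> \<open>A vector orthogonal to every \<open>v\<close> is orthogonal to itself.\<close>
  then show ?thesis
    by (metis inner_eq_zero_iff)
qed

section \<open>Small-ball asymptotics of kernel expectations\<close>

text \<open>On the event \<open>V \<omega> \<le> r\<close>, the value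
  \<open>f (V \<omega> / r)\<close> is \<open>f 1\<close> minus the integral of \<open>f'\<close>
  from \<open>V \<omega> / r\<close> to 1. The condition \<open>V \<omega> / r \<le> s\<close> is
  the event \<open>V \<omega> \<le> r * s\<close>, so exchanging the integrals replaces it by its
  probability. The jump of the cut-off function at 1 is carried by the term with
  \<open>f 1\<close>.\<close>

lemma (in prob_space) expectation_kernel_by_parts:
  fixes V :: "'a \<Rightarrow> real" and f f' :: "real \<Rightarrow> real"
  assumes V [measurable]: "V \<in> borel_measurable M" and V_nonneg: "\<And>\<omega>. \<omega> \<in> space M \<Longrightarrow> V \<omega> \<ge> 0"
    and deriv: "\<And>t. t \<in> {0..1} \<Longrightarrow> (f has_vector_derivative f' t) (at t within {0..1})"
    and cont: "continuous_on {0..1} f'" and r: "r > 0"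
  shows "expectation (\<lambda>\<omega>. if V \<omega> \<le> r then f (V \<omega> / r) else 0) =
      f 1 * prob {\<omega> \<in> space M. V \<omega> \<le> r} -
      (LBINT s:{0..1}. f' s * prob {\<omega> \<in> space M. V \<omega> \<le> r * s})"
proof -
  \<comment> \<open>Extending \<open>f'\<close> by 0 outside the unit interval makes it Borel on the
    whole line, hence the two-variable integrand \<open>k\<close> jointly measurable.\<close>
  define g where "g s = indicator {0..1} s * f' s" for s
  have g [measurable]: "g \<in> borel_measurable borel"
    unfolding g_def using borel_measurable_continuous_on_indicator[OF _ cont] by simp
  define k where "k \<omega> s = (if V \<omega> \<le> r * s then g s else 0)" for \<omega> s
  obtain B where B: "\<bar>f' t\<bar> \<le> B" if "t \<in> {0..1}" for t
    using compact_imp_bounded[OF compact_continuous_image[OF cont compact_Icc]]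
    by (force simp: bounded_iff)
  have B0: "B \<ge> 0" using B[of 0] by simp
  interpret pair_sigma_finite M lborel ..
  \<comment> \<open>Fubini needs absolute integrability: \<open>k\<close> is bounded by
    \<open>B\<close> on a product set of measure 1 and vanishes off it.\<close>
  have k_int: "integrable (M \<Otimes>\<^sub>M lborel) (case_prod k)"
  proof (rule integrableI_bounded_set[where A = "space M \<times> {0..1::real}" and B = B])
    show "emeasure (M \<Otimes>\<^sub>M lborel) (space M \<times> {0..1::real}) < \<infinity>"
      by (subst lborel.emeasure_pair_measure_Times) (auto simp: emeasure_space_1)
    show "case_prod k \<in> borel_measurable (M \<Otimes>\<^sub>M lborel)"
      unfolding k_def by measurable
    show "AE z in M \<Otimes>\<^sub>M lborel. z \<in> space M \<times> {0..1} \<longrightarrow> norm (case_prod k z) \<le> B"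
      using B B0 by (auto simp: k_def g_def)
    show "AE z in M \<Otimes>\<^sub>M lborel. z \<notin> space M \<times> {0..1} \<longrightarrow> case_prod k z = 0"
      by (intro AE_I2) (auto simp: k_def g_def space_pair_measure split: if_splits split_indicator_asm)
  qed auto
  have inner: "(\<integral>s. k \<omega> s \<partial>lborel) = (if V \<omega> \<le> r then f 1 - f (V \<omega> / r) else 0)"
    if "\<omega> \<in> space M" for \<omega>
  proof (cases "V \<omega> \<le> r")
    case True
    define w where "w = V \<omega> / r"
    have w: "w \<in> {0..1}" using True r V_nonneg[OF that] by (simp add: w_def)
    have "(\<integral>s. k \<omega> s \<partial>lborel) = (\<integral>s. indicator {w..1} s *\<^sub>R f' s \<partial>lborel)"
    proof (intro Bochner_Integration.integral_cong refl)
      fix s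
      have "V \<omega> \<le> r * s \<longleftrightarrow> w \<le> s"
        using r by (simp add: w_def field_simps)
      then show "k \<omega> s = indicator {w..1} s *\<^sub>R f' s"
        using w by (auto simp: k_def g_def indicator_def)
    qed
    also have "\<dots> = f 1 - f w"
    proof (rule integral_FTC_Icc)
      show "w \<le> 1" using w by simp
      show "(f has_vector_derivative f' t) (at t within {w..1})" if "w \<le> t" "t \<le> 1" for t
        using that w by (intro has_vector_derivative_within_subset[OF deriv]) auto
      show "continuous_on {w..1} f'"
        using w by (intro continuous_on_subset[OF cont]) auto
    qed
    finally show ?thesis using True by (simp add: w_def)
  next
    case False
    have "k \<omega> s = 0" for s
    proof (cases "s \<in> {0..1}")
      case True
      then have "r * s \<le> r" using r by (simp add: mult_left_le)
      then show ?thesis using False by (simp add: k_def)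
    qed (simp add: k_def g_def)
    then show ?thesis using False by simp
  qed
  have int1: "integrable M (\<lambda>\<omega>. if V \<omega> \<le> r then f 1 else 0)"
    by (rule integrable_const_bound[where B = "\<bar>f 1\<bar>"]) auto
  have int2: "integrable M (\<lambda>\<omega>. \<integral>s. k \<omega> s \<partial>lborel)"
    using integrable_fst'[OF k_int] by simp
  have "expectation (\<lambda>\<omega>. if V \<omega> \<le> r then f (V \<omega> / r) else 0) =
      expectation (\<lambda>\<omega>. (if V \<omega> \<le> r then f 1 else 0) - (\<integral>s. k \<omega> s \<partial>lborel))"
    by (intro Bochner_Integration.integral_cong refl) (simp add: inner)
  also have "\<dots> = expectation (\<lambda>\<omega>. if V \<omega> \<le> r then f 1 else 0) - (\<integral>\<omega>. \<integral>s. k \<omega> s \<partial>lborel \<partial>M)"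
    by (rule Bochner_Integration.integral_diff[OF int1 int2])
  also have "(\<integral>\<omega>. \<integral>s. k \<omega> s \<partial>lborel \<partial>M) = (\<integral>s. \<integral>\<omega>. k \<omega> s \<partial>M \<partial>lborel)"
    using Fubini_integral[OF k_int] by simp
  also have "expectation (\<lambda>\<omega>. if V \<omega> \<le> r then f 1 else 0) = f 1 * prob {\<omega> \<in> space M. V \<omega> \<le> r}"
  proof -
    have "expectation (\<lambda>\<omega>. if V \<omega> \<le> r then f 1 else 0) =
        expectation (\<lambda>\<omega>. f 1 * indicator {\<omega> \<in> space M. V \<omega> \<le> r} \<omega>)"
      by (intro Bochner_Integration.integral_cong refl) auto
    then show ?thesis by simp
  qed
  also have "(\<integral>s. \<integral>\<omega>. k \<omega> s \<partial>M \<partial>lborel) =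
      (LBINT s:{0..1}. f' s * prob {\<omega> \<in> space M. V \<omega> \<le> r * s})"
    unfolding set_lebesgue_integral_def
  proof (intro Bochner_Integration.integral_cong refl)
    fix s
    have "expectation (\<lambda>\<omega>. k \<omega> s) =
        expectation (\<lambda>\<omega>. g s * indicator {\<omega> \<in> space M. V \<omega> \<le> r * s} \<omega>)"
      by (intro Bochner_Integration.integral_cong refl) (auto simp: k_def)
    then show "expectation (\<lambda>\<omega>. k \<omega> s) =
        indicator {0..1} s *\<^sub>R (f' s * prob {\<omega> \<in> space M. V \<omega> \<le> r * s})"
      by (simp add: g_def)
  qed
  finally show ?thesis .
qed

text \<open>Write \<open>F\<close> for the distribution function of \<open>V\<close>. Then
  \<open>F (h * s) / \<phi> h\<close> is the product of \<open>F (h * s) / \<phi> (h * s)\<close>,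
  which tends to \<open>c\<close>, and \<open>\<phi> (h * s) / \<phi> h\<close>, which tends to
  \<open>\<tau> s\<close>. Dividing the formula by parts by \<open>\<phi> h\<close> and passing to
  the limit under the integral gives the result.\<close>

lemma (in prob_space) expectation_kernel_asymp:
  fixes V :: "'a \<Rightarrow> real" and f f' \<phi> \<tau> :: "real \<Rightarrow> real"
  assumes V [measurable]: "V \<in> borel_measurable M" and V_nonneg: "\<And>\<omega>. \<omega> \<in> space M \<Longrightarrow> V \<omega> \<ge> 0"
    and deriv: "\<And>t. t \<in> {0..1} \<Longrightarrow> (f has_vector_derivative f' t) (at t within {0..1})"
    and cont: "continuous_on {0..1} f'"
    and pos: "\<forall>\<^sub>F r in at_right 0. \<phi> r > 0"
    and F: "(\<lambda>r. prob {\<omega> \<in> space M. V \<omega> \<le> r} - \<phi> r * c) \<in> o[at_right 0](\<phi>)"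
    and \<tau>: "\<And>s. s \<in> {0..1} \<Longrightarrow> ((\<lambda>r. \<phi> (r * s) / \<phi> r) \<longlongrightarrow> \<tau> s) (at_right 0)"
    and int: "set_integrable lborel {0..1} (\<lambda>s. f' s * \<tau> s)"
    and h: "filterlim h (at_right 0) sequentially"
  shows "(\<lambda>n. expectation (\<lambda>\<omega>. if V \<omega> \<le> h n then f (V \<omega> / h n) else 0) / \<phi> (h n))
    \<longlonglongrightarrow> c * (f 1 - (LBINT s:{0..1}. f' s * \<tau> s))"
proof -
  define F where "F r = prob {\<omega> \<in> space M. V \<omega> \<le> r}" for r
  have F_mono: "F r \<le> F r'" if "r \<le> r'" for r r'
    unfolding F_def using that by (intro finite_measure_mono) auto
  have [measurable]: "F \<in> borel_measurable borel"
    by (intro borel_measurable_mono monoI F_mono)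
  have F_nonneg: "F r \<ge> 0" for r by (simp add: F_def)
  have F_lim: "((\<lambda>r. F r / \<phi> r) \<longlongrightarrow> c) (at_right 0)"
  proof -
    have "((\<lambda>r. (F r - \<phi> r * c) / \<phi> r + c) \<longlongrightarrow> 0 + c) (at_right 0)"
      using smalloD_tendsto[OF F] unfolding F_def by (intro tendsto_intros)
    moreover have "\<forall>\<^sub>F r in at_right 0. (F r - \<phi> r * c) / \<phi> r + c = F r / \<phi> r"
      using pos by eventually_elim (simp add: field_simps)
    ultimately show ?thesis
      unfolding add_0 by (rule Lim_transform_eventually)
  qed
  \<comment> \<open>The point \<open>s = 0\<close> is left out because \<open>r * s\<close> has to
    approach 0 through positive values; a single point does not affect the integral below.\<close>
  have lim_s: "(\<lambda>n. F (h n * s) / \<phi> (h n)) \<longlonglongrightarrow> c * \<tau> s" if s: "s \<in> {0<..1}" for s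
  proof -
    have scale: "filterlim (\<lambda>r. r * s) (at_right 0) (at_right 0)"
    proof -
      have "((\<lambda>r::real. r * s) \<longlongrightarrow> 0 * s) (at_right 0)"
        by (intro tendsto_intros)
      moreover have "\<forall>\<^sub>F r in at_right 0. r * s \<in> {0<..} \<and> r * s \<noteq> 0"
        using eventually_at_right_less[of 0] by eventually_elim (use s in auto)
      ultimately show ?thesis
        by (auto simp: filterlim_at)
    qed
    have "((\<lambda>r. F (r * s) / \<phi> (r * s) * (\<phi> (r * s) / \<phi> r)) \<longlongrightarrow> c * \<tau> s) (at_right 0)"
      using s by (intro tendsto_mult filterlim_compose[OF F_lim scale] \<tau>) auto
    moreover have "\<forall>\<^sub>F r in at_right 0. \<phi> (r * s) > 0"
      by (rule eventually_compose_filterlim[OF pos scale])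
    then have "\<forall>\<^sub>F r in at_right 0. F (r * s) / \<phi> (r * s) * (\<phi> (r * s) / \<phi> r) = F (r * s) / \<phi> r"
      by eventually_elim simp
    ultimately have "((\<lambda>r. F (r * s) / \<phi> r) \<longlongrightarrow> c * \<tau> s) (at_right 0)"
      by (rule Lim_transform_eventually)
    then show ?thesis
      using h by (rule filterlim_compose)
  qed
  obtain B where B: "\<bar>f' t\<bar> \<le> B" if "t \<in> {0..1}" for t
    using compact_imp_bounded[OF compact_continuous_image[OF cont compact_Icc]]
    by (force simp: bounded_iff)
  have B0: "B \<ge> 0" using B[of 0] by simp
  have lim_h: "(\<lambda>n. F (h n) / \<phi> (h n)) \<longlonglongrightarrow> c"
    using F_lim h by (rule filterlim_compose)
  \<comment> \<open>Any number above the limit \<open>c\<close> would serve; \<open>c + 1\<close>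
    becomes part of the dominating function.\<close>
  have "\<forall>\<^sub>F n in sequentially. F (h n) / \<phi> (h n) < c + 1"
    using lim_h by (rule order_tendstoD) simp
  moreover have "\<forall>\<^sub>F n in sequentially. h n > 0"
    by (rule eventually_compose_filterlim[OF eventually_at_right_less h])
  moreover have "\<forall>\<^sub>F n in sequentially. \<phi> (h n) > 0"
    by (rule eventually_compose_filterlim[OF pos h])
  ultimately have ev: "\<forall>\<^sub>F n in sequentially. F (h n) / \<phi> (h n) < c + 1 \<and> h n > 0 \<and> \<phi> (h n) > 0"
    by eventually_elim simp
  then obtain n0 where n0: "F (h n) / \<phi> (h n) < c + 1" "h n > 0" "\<phi> (h n) > 0" if "n \<ge> n0" for n
    by (auto simp: eventually_sequentially)
  have g [measurable]: "(\<lambda>s. indicator {0..1} s * f' s) \<in> borel_measurable borel"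
    using borel_measurable_continuous_on_indicator[OF _ cont] by simp
  \<comment> \<open>Dominated convergence asks for the bound at every index, whereas it holds only
    from \<open>n0\<close> on. The sequence is therefore shifted by \<open>n0\<close>, and
    \<open>LIMSEQ_offset\<close> undoes the shift afterwards.\<close>
  have "(\<lambda>n. \<integral>s. indicator {0..1} s * f' s * (F (h (n + n0) * s) / \<phi> (h (n + n0))) \<partial>lborel)
      \<longlonglongrightarrow> (\<integral>s. c * (indicator {0..1} s *\<^sub>R (f' s * \<tau> s)) \<partial>lborel)"
  proof (rule integral_dominated_convergence[where w = "\<lambda>s. indicator {0..1} s * (B * (c + 1))"])
    show "(\<lambda>s. c * (indicator {0..1} s *\<^sub>R (f' s * \<tau> s))) \<in> borel_measurable lborel"
      using int unfolding set_integrable_def by (intro borel_measurable_times) auto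
    show "integrable lborel (\<lambda>s::real. indicator {0..1} s * (B * (c + 1)))"
      by (simp add: integrable_real_indicator)
    show "AE s in lborel. (\<lambda>n. indicator {0..1} s * f' s * (F (h (n + n0) * s) / \<phi> (h (n + n0))))
        \<longlonglongrightarrow> c * (indicator {0..1} s *\<^sub>R (f' s * \<tau> s))"
      using AE_lborel_singleton[of 0]
    proof eventually_elim
      case (elim s)
      show ?case
      proof (cases "s \<in> {0..1}")
        case True
        then have "(\<lambda>n. indicator {0..1} s * f' s * (F (h (n + n0) * s) / \<phi> (h (n + n0))))
            \<longlonglongrightarrow> indicator {0..1} s * f' s * (c * \<tau> s)"
          using elim by (intro tendsto_mult tendsto_const LIMSEQ_ignore_initial_segment[OF lim_s]) auto
        then show ?thesis by (simp add: mult_ac)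
      qed simp
    qed
    show "AE s in lborel. norm (indicator {0..1} s * f' s * (F (h (n + n0) * s) / \<phi> (h (n + n0))))
        \<le> indicator {0..1} s * (B * (c + 1))" for n
    proof (intro always_eventually allI)
      fix s :: real
      show "norm (indicator {0..1} s * f' s * (F (h (n + n0) * s) / \<phi> (h (n + n0))))
          \<le> indicator {0..1} s * (B * (c + 1))"
      proof (cases "s \<in> {0..1}")
        case True
        \<comment> \<open>Domination rests on the monotonicity of the distribution function
          \<open>F\<close>: shrinking the radius by \<open>s \<le> 1\<close> can only lower the
          numerator while the denominator stays fixed.\<close>
        have "F (h (n + n0) * s) / \<phi> (h (n + n0)) \<le> F (h (n + n0)) / \<phi> (h (n + n0))"
          using True n0[of "n + n0"] by (intro divide_right_mono F_mono) (auto simp: mult_left_le)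
        also have "\<dots> \<le> c + 1" using n0(1)[of "n + n0"] by simp
        finally have "\<bar>f' s\<bar> * (F (h (n + n0) * s) / \<phi> (h (n + n0))) \<le> B * (c + 1)"
          using B[OF True] B0 n0(3)[of "n + n0"] F_nonneg by (intro mult_mono) auto
        then show ?thesis
          using True n0(3)[of "n + n0"] F_nonneg by (simp add: abs_mult)
      qed simp
    qed
  qed measurable
  then have "(\<lambda>n. \<integral>s. indicator {0..1} s * f' s * (F (h n * s) / \<phi> (h n)) \<partial>lborel)
      \<longlonglongrightarrow> c * (LBINT s:{0..1}. f' s * \<tau> s)"
    unfolding set_lebesgue_integral_def integral_mult_right_zero by (rule LIMSEQ_offset)
  then have "(\<lambda>n. f 1 * (F (h n) / \<phi> (h n)) -
      (\<integral>s. indicator {0..1} s * f' s * (F (h n * s) / \<phi> (h n)) \<partial>lborel))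
      \<longlonglongrightarrow> f 1 * c - c * (LBINT s:{0..1}. f' s * \<tau> s)"
    by (intro tendsto_diff tendsto_mult tendsto_const lim_h)
  moreover have "\<forall>\<^sub>F n in sequentially.
      f 1 * (F (h n) / \<phi> (h n)) - (\<integral>s. indicator {0..1} s * f' s * (F (h n * s) / \<phi> (h n)) \<partial>lborel) =
      expectation (\<lambda>\<omega>. if V \<omega> \<le> h n then f (V \<omega> / h n) else 0) / \<phi> (h n)"
    using ev
  proof eventually_elim
    case (elim n)
    have "(\<integral>s. indicator {0..1} s * f' s * (F (h n * s) / \<phi> (h n)) \<partial>lborel) =
        (\<integral>s. indicator {0..1} s *\<^sub>R (f' s * F (h n * s)) / \<phi> (h n) \<partial>lborel)"
      by (simp add: mult_ac)
    then show ?case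
      using elim expectation_kernel_by_parts[OF V V_nonneg deriv cont, of "h n"]
      by (simp add: F_def set_lebesgue_integral_def diff_divide_distrib)
  qed
  ultimately have "(\<lambda>n. expectation (\<lambda>\<omega>. if V \<omega> \<le> h n then f (V \<omega> / h n) else 0) / \<phi> (h n))
      \<longlonglongrightarrow> f 1 * c - c * (LBINT s:{0..1}. f' s * \<tau> s)"
    by (rule Lim_transform_eventually)
  then show ?thesis
    by (simp add: right_diff_distrib mult.commute)
qed

section \<open>Kernel averages: integrability, conditioning and first-order expansion\<close>

text \<open>The kernel factor vanishes unless \<open>V \<omega>\<close> lies between 0 and
  \<open>r\<close>, and on this compact interval the continuous function \<psi> is bounded, although
  it may be unbounded on the line.\<close>

lemma (in prob_space) integrable_kernel_scaleR:
  fixes V :: "'a \<Rightarrow> real" and \<psi> :: "real \<Rightarrow> 'b::{banach, second_countable_topology}"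
  assumes [measurable]: "V \<in> borel_measurable M" "K \<in> borel_measurable borel"
    and K_bdd: "\<And>t. \<bar>K t\<bar> \<le> B" and K_supp: "\<And>t. t \<notin> {0..1} \<Longrightarrow> K t = 0"
    and cont: "continuous_on UNIV \<psi>" and r: "r > 0"
  shows "integrable M (\<lambda>\<omega>. K (V \<omega> / r) *\<^sub>R \<psi> (V \<omega>))"
proof -
  have [measurable]: "\<psi> \<in> borel_measurable borel"
    by (rule borel_measurable_continuous_onI[OF cont])
  have "bounded (\<psi> ` {0..r})"
    by (intro compact_imp_bounded compact_continuous_image continuous_on_subset[OF cont]) auto
  then obtain C where C: "norm (\<psi> v) \<le> C" if "v \<in> {0..r}" for v
    by (force simp: bounded_iff)
  have C0: "C \<ge> 0" using C[of 0] r by (smt (verit) atLeastAtMost_iff norm_ge_zero)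
  have B0: "B \<ge> 0" using K_bdd[of 0] by simp
  show ?thesis
  proof (rule integrable_const_bound[where B = "B * C"])
    show "AE \<omega> in M. norm (K (V \<omega> / r) *\<^sub>R \<psi> (V \<omega>)) \<le> B * C"
    proof (intro always_eventually allI)
      fix \<omega>
      show "norm (K (V \<omega> / r) *\<^sub>R \<psi> (V \<omega>)) \<le> B * C"
      proof (cases "V \<omega> / r \<in> {0..1}")
        case True
        then have "V \<omega> \<in> {0..r}" using r by (simp add: field_simps)
        then show ?thesis
          using K_bdd C B0 by (auto intro!: mult_mono)
      next
        case False
        then show ?thesis using K_supp B0 C0 by simp
      qed
    qed
  qed measurable
qed

text \<open>The weight \<open>k (V \<omega>)\<close> is measurable for the sigma-algebra generated
  by \<open>V\<close> and may be moved through the conditional expectation. The argument runs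
  coordinate by coordinate, as does \<open>cond_exp_given\<close>.\<close>

lemma (in prob_space) expectation_scaleR_cond_exp_given:
  fixes V :: "'a \<Rightarrow> real" and Z :: "'a \<Rightarrow> real^'n"
  assumes cond: "cond_exp_given M V Z \<psi>"
    and V [measurable]: "V \<in> borel_measurable M" and Z [measurable]: "Z \<in> borel_measurable M"
    and k [measurable]: "k \<in> borel_measurable borel"
    and int_Z: "integrable M (\<lambda>\<omega>. k (V \<omega>) *\<^sub>R Z \<omega>)"
    and int_\<psi>: "integrable M (\<lambda>\<omega>. k (V \<omega>) *\<^sub>R \<psi> (V \<omega>))"
  shows "expectation (\<lambda>\<omega>. k (V \<omega>) *\<^sub>R Z \<omega>) = expectation (\<lambda>\<omega>. k (V \<omega>) *\<^sub>R \<psi> (V \<omega>))"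
proof -
  let ?F = "vimage_algebra (space M) V borel"
  have "subalgebra M ?F"
    using sets_image_in_sets[OF _ V] by (simp add: subalgebra_def)
  then interpret finite_measure_subalgebra M ?F
    by unfold_locales
  have \<psi> [measurable]: "\<psi> \<in> borel_measurable borel"
    using cond by (simp add: cond_exp_given_def)
  have V_F: "V \<in> borel_measurable ?F"
    by (rule measurable_vimage_algebra1) auto
  have nth: "(\<integral>\<omega>. f \<omega> \<partial>M) $ i = (\<integral>\<omega>. f \<omega> $ i \<partial>M)" if "integrable M f" for f :: "'a \<Rightarrow> real^'n" and i
    using integral_bounded_linear[OF bounded_linear_vec_nth that] by simp
  have "expectation (\<lambda>\<omega>. k (V \<omega>) *\<^sub>R Z \<omega>) $ i = expectation (\<lambda>\<omega>. k (V \<omega>) *\<^sub>R \<psi> (V \<omega>)) $ i" for i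
  proof -
    have [measurable]: "(\<lambda>z::real^'n. z $ i) \<in> borel_measurable borel"
      by (intro borel_measurable_continuous_onI continuous_intros)
    have Zi [measurable]: "(\<lambda>\<omega>. Z \<omega> $ i) \<in> borel_measurable M"
      by measurable
    have int_i: "integrable M (\<lambda>\<omega>. k (V \<omega>) * Z \<omega> $ i)"
      using integrable_bounded_linear[OF bounded_linear_vec_nth int_Z, of i] by simp
    have "expectation (\<lambda>\<omega>. k (V \<omega>) *\<^sub>R Z \<omega>) $ i = (\<integral>\<omega>. k (V \<omega>) * Z \<omega> $ i \<partial>M)"
      using nth[OF int_Z] by simp
    also have "\<dots> = (\<integral>\<omega>. k (V \<omega>) * real_cond_exp M ?F (\<lambda>\<omega>. Z \<omega> $ i) \<omega> \<partial>M)"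
      by (rule real_cond_exp_intg(2)[symmetric, OF int_i _ Zi]) (rule measurable_compose[OF V_F k])
    also have "\<dots> = (\<integral>\<omega>. k (V \<omega>) * \<psi> (V \<omega>) $ i \<partial>M)"
    proof (rule integral_cong_AE)
      have "real_cond_exp M ?F (\<lambda>\<omega>. Z \<omega> $ i) \<in> borel_measurable M"
        by (rule measurable_from_subalg[OF subalg]) simp
      then show "(\<lambda>\<omega>. k (V \<omega>) * real_cond_exp M ?F (\<lambda>\<omega>. Z \<omega> $ i) \<omega>) \<in> borel_measurable M"
        by measurable
      have "AE \<omega> in M. real_cond_exp M ?F (\<lambda>\<omega>. Z \<omega> $ i) \<omega> = \<psi> (V \<omega>) $ i"
        using cond by (simp add: cond_exp_given_def)
      then show "AE \<omega> in M. k (V \<omega>) * real_cond_exp M ?F (\<lambda>\<omega>. Z \<omega> $ i) \<omega> = k (V \<omega>) * \<psi> (V \<omega>) $ i"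
        by eventually_elim simp
    qed measurable
    also have "\<dots> = expectation (\<lambda>\<omega>. k (V \<omega>) *\<^sub>R \<psi> (V \<omega>)) $ i"
      using nth[OF int_\<psi>] by simp
    finally show ?thesis .
  qed
  then show ?thesis by (simp add: vec_eq_iff)
qed

text \<open>Where the weight \<open>K (V \<omega> / h n)\<close> is nonzero,
  \<open>V \<omega>\<close> is at most \<open>h n\<close>, so the Taylor remainder of \<psi> at 0 is
  small relative to \<open>h n\<close>, uniformly over these \<omega>. Averaging with nonnegative
  weights preserves this bound. The coefficient of \<open>\<psi>'\<close> is kept as a quotient; its
  limit is a separate matter of small-ball asymptotics.\<close>

lemma (in prob_space) kernel_average_first_order:
  fixes V :: "'a \<Rightarrow> real" and \<psi> :: "real \<Rightarrow> 'b::{banach, second_countable_topology}"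
  assumes V [measurable]: "V \<in> borel_measurable M" and K [measurable]: "K \<in> borel_measurable borel"
    and K_nonneg: "\<And>t. 0 \<le> K t" and K_bdd: "\<And>t. K t \<le> B"
    and K_supp: "\<And>t. t \<notin> {0..1} \<Longrightarrow> K t = 0"
    and cont: "continuous_on UNIV \<psi>"
    and \<psi>0: "\<psi> 0 = 0" and deriv: "(\<psi> has_vector_derivative \<psi>') (at 0)"
    and h_pos: "\<And>n. h n > 0" and h: "h \<longlonglongrightarrow> 0"
    and pos: "\<forall>\<^sub>F n in sequentially. expectation (\<lambda>\<omega>. K (V \<omega> / h n)) > 0"
  shows "(\<lambda>n. expectation (\<lambda>\<omega>. K (V \<omega> / h n) *\<^sub>R \<psi> (V \<omega>)) /\<^sub>R
        (h n * expectation (\<lambda>\<omega>. K (V \<omega> / h n))) -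
      (expectation (\<lambda>\<omega>. V \<omega> / h n * K (V \<omega> / h n)) / expectation (\<lambda>\<omega>. K (V \<omega> / h n))) *\<^sub>R \<psi>')
    \<longlonglongrightarrow> 0"
proof (rule LIMSEQ_I)
  fix e :: real
  assume e: "e > 0"
  have "\<forall>e>0. \<exists>d>0. \<forall>v. norm (v - 0) < d \<longrightarrow> norm (\<psi> v - \<psi> 0 - (v - 0) *\<^sub>R \<psi>') \<le> e * norm (v - 0)"
    using deriv unfolding has_vector_derivative_def has_derivative_at_alt by blast
  \<comment> \<open>Half of \<open>e\<close> leaves room for the strict inequality at the
    end.\<close>
  then obtain \<delta> where \<delta>: "\<delta> > 0" "\<And>v. \<bar>v\<bar> < \<delta> \<Longrightarrow> norm (\<psi> v - v *\<^sub>R \<psi>') \<le> e / 2 * \<bar>v\<bar>"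
    using e \<psi>0 by (metis diff_zero half_gt_zero real_norm_def)
  have "\<forall>\<^sub>F n in sequentially. h n < \<delta>"
    using h \<delta>(1) by (rule order_tendstoD)
  then have "\<forall>\<^sub>F n in sequentially. norm
      (expectation (\<lambda>\<omega>. K (V \<omega> / h n) *\<^sub>R \<psi> (V \<omega>)) /\<^sub>R
        (h n * expectation (\<lambda>\<omega>. K (V \<omega> / h n))) -
      (expectation (\<lambda>\<omega>. V \<omega> / h n * K (V \<omega> / h n)) / expectation (\<lambda>\<omega>. K (V \<omega> / h n))) *\<^sub>R \<psi>' - 0) < e"
    using pos
  proof eventually_elim
    case (elim n)
    define E where "E = expectation (\<lambda>\<omega>. K (V \<omega> / h n))"
    have E: "E > 0" using elim by (simp add: E_def)
    have hn: "h n > 0" by (rule h_pos)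
    have K_abs: "\<bar>K t\<bar> \<le> B" for t using K_nonneg K_bdd by simp
    note int = integrable_kernel_scaleR[OF V K K_abs K_supp _ hn]
    have int_\<psi>: "integrable M (\<lambda>\<omega>. K (V \<omega> / h n) *\<^sub>R \<psi> (V \<omega>))"
      by (rule int[OF _ cont])
    have int_K: "integrable M (\<lambda>\<omega>. K (V \<omega> / h n))"
      using int[of "\<lambda>_. 1::real"] by simp
    have int_VK: "integrable M (\<lambda>\<omega>. V \<omega> / h n * K (V \<omega> / h n))"
      using int[of "\<lambda>v. v / h n"] hn by (simp add: mult.commute continuous_intros)
    have int_V: "integrable M (\<lambda>\<omega>. V \<omega> * K (V \<omega> / h n))"
      using integrable_mult_right[OF int_VK, of "h n"] hn by simp
    have int_V\<psi>': "integrable M (\<lambda>\<omega>. (V \<omega> * K (V \<omega> / h n)) *\<^sub>R \<psi>')"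
      using int_V by simp
    \<comment> \<open>\<open>R\<close> is the weighted average of the Taylor remainder; subtracting
      the linear term leaves exactly \<open>R\<close> divided by \<open>h n * E\<close>.\<close>
    define R where "R = expectation (\<lambda>\<omega>. K (V \<omega> / h n) *\<^sub>R (\<psi> (V \<omega>) - V \<omega> *\<^sub>R \<psi>'))"
    have "R = expectation (\<lambda>\<omega>. K (V \<omega> / h n) *\<^sub>R \<psi> (V \<omega>)) -
        expectation (\<lambda>\<omega>. V \<omega> * K (V \<omega> / h n)) *\<^sub>R \<psi>'"
      unfolding R_def using int_\<psi> int_V int_V\<psi>'
      by (simp add: scaleR_diff_right mult.commute)
    moreover have "expectation (\<lambda>\<omega>. V \<omega> * K (V \<omega> / h n)) =
        h n * expectation (\<lambda>\<omega>. V \<omega> / h n * K (V \<omega> / h n))"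
      using hn by simp
    ultimately have eq: "expectation (\<lambda>\<omega>. K (V \<omega> / h n) *\<^sub>R \<psi> (V \<omega>)) /\<^sub>R (h n * E) -
        (expectation (\<lambda>\<omega>. V \<omega> / h n * K (V \<omega> / h n)) / E) *\<^sub>R \<psi>' = R /\<^sub>R (h n * E)"
      using hn by (simp add: scaleR_diff_right divide_inverse mult_ac)
    have "norm R \<le> expectation (\<lambda>\<omega>. e / 2 * h n * K (V \<omega> / h n))"
      unfolding R_def
    proof (rule order_trans[OF Bochner_Integration.integral_norm_bound Bochner_Integration.integral_mono])
      show "integrable M (\<lambda>\<omega>. norm (K (V \<omega> / h n) *\<^sub>R (\<psi> (V \<omega>) - V \<omega> *\<^sub>R \<psi>')))"
        by (intro integrable_norm) (use int_\<psi> int_V\<psi>' in \<open>simp add: scaleR_diff_right mult.commute\<close>)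
      show "integrable M (\<lambda>\<omega>. e / 2 * h n * K (V \<omega> / h n))"
        using int_K by simp
      show "norm (K (V \<omega> / h n) *\<^sub>R (\<psi> (V \<omega>) - V \<omega> *\<^sub>R \<psi>')) \<le> e / 2 * h n * K (V \<omega> / h n)" for \<omega>
      proof (cases "V \<omega> / h n \<in> {0..1}")
        case True
        then have v: "0 \<le> V \<omega>" "V \<omega> \<le> h n" using hn by (simp_all add: field_simps)
        have "norm (\<psi> (V \<omega>) - V \<omega> *\<^sub>R \<psi>') \<le> e / 2 * \<bar>V \<omega>\<bar>"
          using v elim by (intro \<delta>(2)) simp
        also have "\<dots> \<le> e / 2 * h n"
          using v e by simp
        finally have "norm (\<psi> (V \<omega>) - V \<omega> *\<^sub>R \<psi>') * K (V \<omega> / h n) \<le> e / 2 * h n * K (V \<omega> / h n)"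
          by (rule mult_right_mono[OF _ K_nonneg])
        then show ?thesis
          by (simp add: K_nonneg mult.commute)
      next
        case False
        then show ?thesis using K_supp by simp
      qed
    qed
    then have "norm R \<le> e / 2 * (h n * E)"
      by (simp add: E_def mult_ac)
    then have "norm (R /\<^sub>R (h n * E)) \<le> e / 2"
      using hn E by (simp add: divide_simps mult_ac)
    then show ?case
      unfolding diff_zero E_def[symmetric] eq using e by simp
  qed
  then show "\<exists>n0. \<forall>n\<ge>n0. norm
      (expectation (\<lambda>\<omega>. K (V \<omega> / h n) *\<^sub>R \<psi> (V \<omega>)) /\<^sub>R
        (h n * expectation (\<lambda>\<omega>. K (V \<omega> / h n))) -
      (expectation (\<lambda>\<omega>. V \<omega> / h n * K (V \<omega> / h n)) / expectation (\<lambda>\<omega>. K (V \<omega> / h n))) *\<^sub>R \<psi>' - 0) < e"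
    by (simp add: eventually_sequentially)
qed

section \<open>Reduction of the gradient bias to one observation\<close>

text \<open>By linearity the numerator is \<open>n\<close> times the expectation of one summand, and
  this \<open>n\<close> cancels. The condition \<open>n \<ge> 1\<close> matters: for
  \<open>n = 0\<close> the estimator is 0 by the convention for division by zero, whatever the
  right-hand side is.\<close>

lemma (in prob_space) grad_bias_identically_distributed:
  fixes X :: "'a \<Rightarrow> 'f" and Y :: "'a \<Rightarrow> real^'n"
  assumes X [measurable]: "X \<in> M \<rightarrow>\<^sub>M N" and Y [measurable]: "Y \<in> borel_measurable M"
    and XY_meas: "\<And>i. i \<ge> 1 \<Longrightarrow> (\<lambda>\<omega>. (Xs i \<omega>, Ys i \<omega>)) \<in> M \<rightarrow>\<^sub>M N \<Otimes>\<^sub>M borel"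
    and ident: "\<And>i. i \<ge> 1 \<Longrightarrow>
        distr M (N \<Otimes>\<^sub>M borel) (\<lambda>\<omega>. (Xs i \<omega>, Ys i \<omega>)) =
        distr M (N \<Otimes>\<^sub>M borel) (\<lambda>\<omega>. (X \<omega>, Y \<omega>))"
    and d [measurable]: "d x \<in> borel_measurable N"
    and K [measurable]: "K \<in> borel_measurable borel" and K_bdd: "\<And>t. \<bar>K t\<bar> \<le> B"
    and n: "n \<ge> (1::nat)"
  shows "grad_bias M d K h Xs Ys x n \<mu> =
    - (expectation (\<lambda>\<omega>. K (d x (X \<omega>) / h) *\<^sub>R sgn (Y \<omega> - \<mu>)) /\<^sub>R expectation (\<lambda>\<omega>. K (d x (X \<omega>) / h)))"
proof -
  \<comment> \<open>The target type is left general, since the fact serves both the scalar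
    denominator and the vector-valued numerator.\<close>
  have transfer: "expectation (\<lambda>\<omega>. f (Xs i \<omega>, Ys i \<omega>)) = expectation (\<lambda>\<omega>. f (X \<omega>, Y \<omega>))"
    if i: "i \<ge> 1" and f: "f \<in> borel_measurable (N \<Otimes>\<^sub>M borel)"
    for i and f :: "'f \<times> (real^'n) \<Rightarrow> 'c::{banach, second_countable_topology}"
    using integral_distr[OF XY_meas[OF i] f] integral_distr[of "\<lambda>\<omega>. (X \<omega>, Y \<omega>)" M "N \<Otimes>\<^sub>M borel" f] f
    by (simp add: ident[OF i])
  have k [measurable]: "(\<lambda>(a, b). K (d x a / h) *\<^sub>R sgn (b - \<mu>)) \<in> borel_measurable (N \<Otimes>\<^sub>M borel)"
    by measurable
  define E where "E = expectation (\<lambda>\<omega>. K (d x (X \<omega>) / h))"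
  define T where "T = expectation (\<lambda>\<omega>. K (d x (X \<omega>) / h) *\<^sub>R sgn (Y \<omega> - \<mu>))"
  have E: "expectation (\<lambda>\<omega>. K (d x (Xs 1 \<omega>) / h)) = E"
    using transfer[of 1 "\<lambda>(a, b). K (d x a / h)"] by (simp add: E_def)
  have T: "expectation (\<lambda>\<omega>. K (d x (Xs i \<omega>) / h) *\<^sub>R sgn (Ys i \<omega> - \<mu>)) = T" if "i \<ge> 1" for i
    using transfer[OF that k] by (simp add: T_def)
  have int: "integrable M (\<lambda>\<omega>. K (d x (Xs i \<omega>) / h) *\<^sub>R sgn (Ys i \<omega> - \<mu>))" if "i \<ge> 1" for i
  proof (rule integrable_const_bound[where B = B])
    show "(\<lambda>\<omega>. K (d x (Xs i \<omega>) / h) *\<^sub>R sgn (Ys i \<omega> - \<mu>)) \<in> borel_measurable M"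
      using measurable_compose[OF XY_meas[OF that] k] by simp
    show "AE \<omega> in M. norm (K (d x (Xs i \<omega>) / h) *\<^sub>R sgn (Ys i \<omega> - \<mu>)) \<le> B"
      using K_bdd order_trans[OF abs_ge_zero K_bdd] by (intro always_eventually allI) (simp add: norm_sgn)
  qed
  have "grad_bias M d K h Xs Ys x n \<mu> =
      - (expectation (\<lambda>\<omega>. \<Sum>i=1..n. K (d x (Xs i \<omega>) / h) *\<^sub>R sgn (Ys i \<omega> - \<mu>)) /\<^sub>R (real n * E))"
    unfolding grad_bias_def grad_est_def kernel_weight_def E by simp
  also have "expectation (\<lambda>\<omega>. \<Sum>i=1..n. K (d x (Xs i \<omega>) / h) *\<^sub>R sgn (Ys i \<omega> - \<mu>)) = (\<Sum>i=1..n. T)"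
    using int by (simp add: T)
  \<comment> \<open>This also covers \<open>E = 0\<close>, where both sides are 0 because the
    inverse of 0 is 0.\<close>
  also have "- ((\<Sum>i=1..n. T) /\<^sub>R (real n * E)) = - (T /\<^sub>R E)"
    using n by (simp add: sum_constant_scaleR del: sum_constant)
  finally show ?thesis by (simp add: T_def E_def)
qed

theorem proposition3p3:
  fixes M :: "'w measure" and N :: "'f::real_vector measure"
    and d :: "'f \<Rightarrow> 'f \<Rightarrow> real"
    and X :: "'w \<Rightarrow> 'f" and Y :: "'w \<Rightarrow> real^'n"
    and Xs :: "nat \<Rightarrow> 'w \<Rightarrow> 'f" and Ys :: "nat \<Rightarrow> 'w \<Rightarrow> real^'n"
    and h :: "nat \<Rightarrow> real"
    and \<kappa> :: "'f \<Rightarrow> (real^'n) measure"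
    and x :: 'f and \<mu> :: "real^'n"
    and K :: "real \<Rightarrow> real" and g :: "'f \<Rightarrow> real"
    and \<phi> \<tau>0 :: "real \<Rightarrow> real" and \<psi> :: "real \<Rightarrow> real^'n"
  assumes dim: "CARD('n) \<ge> 2"
    and inf_dim: "infinite_dimensional TYPE('f)"
    and d_semi: "semi_metric d"
    and N_space: "space N = UNIV"
    and d_meas: "\<And>z. d z \<in> borel_measurable N"
    and prob: "prob_space M"
    and X_rv: "X \<in> M \<rightarrow>\<^sub>M N"
    and Y_rv: "Y \<in> borel_measurable M"
    and Y_int: "integrable M (\<lambda>\<omega>. norm (Y \<omega>))"
    and indep: "prob_space.indep_vars M (\<lambda>_. N \<Otimes>\<^sub>M borel) (\<lambda>i \<omega>. (Xs i \<omega>, Ys i \<omega>)) {1..}"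
    and ident: "\<And>i. i \<ge> 1 \<Longrightarrow>
        distr M (N \<Otimes>\<^sub>M borel) (\<lambda>\<omega>. (Xs i \<omega>, Ys i \<omega>)) =
        distr M (N \<Otimes>\<^sub>M borel) (\<lambda>\<omega>. (X \<omega>, Y \<omega>))"
    and h_pos: "\<And>n. h n > 0" and h_dec: "decseq h" and h_lim: "h \<longlonglongrightarrow> 0"
    and kappa: "regular_cond_distr M N X Y \<kappa>"
    and kappa_int: "integrable (\<kappa> x) (\<lambda>y. norm y)"
    and G_diff: "\<And>u. L1_criterion (\<kappa> x) differentiable (at u)"
    and G_bdd: "\<And>S. bounded S \<Longrightarrow> bounded (L1_criterion (\<kappa> x) ` S)"
    and not_line: "\<not> supported_on_line (\<kappa> x)"
    and median: "is_L1_median (\<kappa> x) \<mu>"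
    and H_ex: "integrable (\<kappa> x) (\<lambda>y. hess_integrand y \<mu>)"
    and H_inv: "invertible (L1_hessian (\<kappa> x) \<mu>)"
    \<comment> \<open>(a)\<close>
    and K_nonneg: "\<And>t. K t \<ge> 0"
    and K_bdd: "bounded (range K)"
    and K_supp: "closure {t. K t \<noteq> 0} = {0..1}"
    and K_one: "K 1 > 0"
    and K_diff: "\<And>t. t \<in> {0..1} \<Longrightarrow> K differentiable (at t within {0..1})"
    and K_C1: "continuous_on {0..1} (deriv01 K)"
    and K_deriv_neg: "\<And>t. t \<in> {0..1} \<Longrightarrow> deriv01 K t < 0"
    and K_int: "\<And>j::nat. j \<in> {1, 2} \<Longrightarrow> set_integrable lborel {0..1} (deriv01 (\<lambda>t. K t ^ j))"
    \<comment> \<open>(b)\<close>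
    and g_nonneg: "\<And>z. g z \<ge> 0" and g_bdd: "bounded (range g)"
    and phi_nonneg: "\<And>r. r \<ge> 0 \<Longrightarrow> \<phi> r \<ge> 0"
    and phi_pos: "\<forall>\<^sub>F r in at_right 0. \<phi> r > 0"
    and phi_lim: "(\<phi> \<longlongrightarrow> 0) (at_right 0)"
    and F_asymp: "(\<lambda>r. measure M {\<omega>\<in>space M. X \<omega> \<in> semi_ball d x r} - \<phi> r * g x)
                    \<in> o[at_right 0](\<phi>)"
    and tau_mono: "mono_on {0..1} \<tau>0" and tau_bdd: "bounded (\<tau>0 ` {0..1})"
    and tau_lim: "uniform_limit {0..1} (\<lambda>r s. \<phi> (r * s) / \<phi> r) \<tau>0 (at_right 0)"
    and tau_int: "\<And>j::nat. j \<ge> 1 \<Longrightarrow>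
        set_integrable lborel {0..1} (\<lambda>t. deriv01 (\<lambda>t. K t ^ j) t * \<tau>0 t)"
    \<comment> \<open>(c); the value at \<open>0\<close> is the conditional expectation given \<open>X = x\<close>\<close>
    and psi: "cond_exp_given M (\<lambda>\<omega>. d x (X \<omega>)) (\<lambda>\<omega>. sgn (Y \<omega> - \<mu>)) \<psi>"
    and psi_zero: "\<psi> 0 = (\<integral>y. sgn (y - \<mu>) \<partial>\<kappa> x)"
    and psi_diff: "\<And>v. \<psi> differentiable (at v)"
    and psi_deriv: "vector_derivative \<psi> (at 0) \<noteq> 0"
    \<comment> \<open>(d)\<close>
    and g_pos: "g x > 0"
    and sK_int: "set_integrable lborel {0..1} (\<lambda>s. deriv01 (\<lambda>s. s * K s) s * \<tau>0 s)"
  shows "\<exists>\<epsilon> :: nat \<Rightarrow> 'w \<Rightarrow> real^'n. small_o_as M \<epsilon> \<and>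
    (\<forall>n\<ge>1. \<forall>\<omega>\<in>space M.
      cond_bias M d K (h n) Xs Ys x (\<kappa> x) n \<mu> =
        - ((h n / kernel_const K \<tau>0 1) *\<^sub>R
           (((LBINT s:{0..1}. deriv01 (\<lambda>s. s * K s) s * \<tau>0 s) - K 1) *\<^sub>R
              (matrix_inv (L1_hessian (\<kappa> x) \<mu>) *v vector_derivative \<psi> (at 0))
            + \<epsilon> n \<omega>)))"
proof -

  \<comment> \<open>Notation for the distance and the kernel averages\<close>
  interpret prob_space M by (rule prob)
  define V where "V \<omega> = d x (X \<omega>)" for \<omega>
  define c where "c = kernel_const K \<tau>0 1"
  define I where "I = (LBINT s:{0..1}. deriv01 (\<lambda>s. s * K s) s * \<tau>0 s)"
  define \<psi>' where "\<psi>' = vector_derivative \<psi> (at 0)"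
  define A where "A = matrix_inv (L1_hessian (\<kappa> x) \<mu>)"
  define E where "E n = expectation (\<lambda>\<omega>. K (V \<omega> / h n))" for n
  define D where "D n = expectation (\<lambda>\<omega>. V \<omega> / h n * K (V \<omega> / h n))" for n
  define T where "T n = expectation (\<lambda>\<omega>. K (V \<omega> / h n) *\<^sub>R sgn (Y \<omega> - \<mu>))" for n
  have V [measurable]: "V \<in> borel_measurable M"
    unfolding V_def by (rule measurable_compose[OF X_rv d_meas])
  have V_nonneg: "V \<omega> \<ge> 0" for \<omega>
    using d_semi by (simp add: V_def semi_metric_def)
  note [measurable] = Y_rv
  have h_right: "filterlim h (at_right 0) sequentially"
    using h_lim h_pos by (simp add: filterlim_at less_imp_neq[THEN not_sym])

  \<comment> \<open>Regularity of the kernel on the unit interval\<close>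
  have K0: "K t = 0" if "t \<notin> {0..1}" for t
    using that closure_subset[of "{t. K t \<noteq> 0}"] unfolding K_supp by auto
  obtain B where B: "\<bar>K t\<bar> \<le> B" for t
    using K_bdd by (auto simp: bounded_iff)
  have K_deriv: "(K has_vector_derivative deriv01 K t) (at t within {0..1})" if "t \<in> {0..1}" for t
    using K_diff[OF that] by (simp add: deriv01_def vector_derivative_works)
  have K_cont: "continuous_on {0..1} K"
    using K_diff by (intro differentiable_imp_continuous_on) (simp add: differentiable_on_def)
  \<comment> \<open>The kernel jumps at 1, so its measurability comes from continuity on the closed
    interval together with its vanishing outside.\<close>
  have "(\<lambda>t. indicator {0..1} t *\<^sub>R K t) = K"
    using K0 by (auto simp: fun_eq_iff indicator_def of_bool_def)
  then have K_meas [measurable]: "K \<in> borel_measurable borel"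
    using borel_measurable_continuous_on_indicator[OF _ K_cont] by simp
  have sK_deriv: "((\<lambda>s. s * K s) has_vector_derivative (K t + t * deriv01 K t)) (at t within {0..1})"
    if "t \<in> {0..1}" for t
    using K_deriv[OF that] unfolding has_real_derivative_iff_has_vector_derivative[symmetric]
    by (auto intro!: derivative_eq_intros)
  \<comment> \<open>\<open>deriv01\<close> selects some derivative; within a nondegenerate closed
    interval the derivative is unique, so it is the one from the product rule.\<close>
  have sK_deriv01: "deriv01 (\<lambda>s. s * K s) t = K t + t * deriv01 K t" if "t \<in> {0..1}" for t
    unfolding deriv01_def[of "\<lambda>s. s * K s"]
    using that sK_deriv by (intro vector_derivative_within_closed_interval) auto
  have sK_cont: "continuous_on {0..1} (deriv01 (\<lambda>s. s * K s))"
  proof -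
    have "continuous_on {0..1} (\<lambda>t. K t + t * deriv01 K t)"
      by (intro continuous_intros K_cont K_C1)
    then show ?thesis
      by (rule continuous_on_eq) (simp add: sK_deriv01)
  qed

  \<comment> \<open>Limits of the kernel averages and of their ratio\<close>
  have F: "(\<lambda>r. prob {\<omega> \<in> space M. V \<omega> \<le> r} - \<phi> r * g x) \<in> o[at_right 0](\<phi>)"
    using F_asymp by (simp add: V_def semi_ball_def)
  have \<tau>: "((\<lambda>r. \<phi> (r * s) / \<phi> r) \<longlongrightarrow> \<tau>0 s) (at_right 0)" if "s \<in> {0..1}" for s
    using tau_lim that by (rule tendsto_uniform_limitI)
  have \<tau>_nonneg: "\<tau>0 s \<ge> 0" if "s \<in> {0..1}" for s
  proof (rule tendsto_lowerbound[OF \<tau>[OF that]])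
    show "\<forall>\<^sub>F r in at_right 0. 0 \<le> \<phi> (r * s) / \<phi> r"
      using eventually_at_right_less[of 0]
      by eventually_elim (use that in \<open>simp add: phi_nonneg\<close>)
  qed simp
  have c_eq: "c = K 1 - (LBINT s:{0..1}. deriv01 K s * \<tau>0 s)"
    by (simp add: c_def kernel_const_def)
  \<comment> \<open>Since \<open>K'\<close> is negative and \<open>\<tau>0\<close> nonnegative, the
    subtracted integral is at most 0, whence \<open>c \<ge> K 1 > 0\<close>. This positivity permits
    division by the average of the kernel.\<close>
  have c_pos: "c > 0"
  proof -
    have "0 \<le> (LBINT s:{0..1}. - (deriv01 K s * \<tau>0 s))"
      unfolding set_lebesgue_integral_def using K_deriv_neg \<tau>_nonneg
      by (intro integral_nonneg_AE AE_I2)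
        (auto simp: indicator_def mult_nonpos_nonneg less_imp_le)
    then show ?thesis
      using K_one by (simp add: c_eq set_lebesgue_integral_def)
  qed
  \<comment> \<open>For a function supported in the unit interval the cut-off at \<open>h n\<close>
    changes nothing, so the asymptotic lemma applies to the plain kernel averages.\<close>
  have kernel_if: "(if V \<omega> \<le> h n then f (V \<omega> / h n) else 0) = f (V \<omega> / h n)"
    if "\<forall>t. t \<notin> {0..1} \<longrightarrow> f t = 0" for f :: "real \<Rightarrow> real" and \<omega> n
    using that[rule_format, of "V \<omega> / h n"] h_pos[of n] by (auto simp: field_simps)
  have E_lim: "(\<lambda>n. E n / \<phi> (h n)) \<longlonglongrightarrow> g x * c"
    using expectation_kernel_asymp[OF V V_nonneg K_deriv K_C1 phi_pos F \<tau> _ h_right] tau_int[of 1]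
    by (simp add: E_def c_eq kernel_if[of K] K0)
  \<comment> \<open>This is the asymptotic lemma for \<open>s * K s\<close>, whose value at 1 is
    again \<open>K 1\<close>.\<close>
  have D_lim: "(\<lambda>n. D n / \<phi> (h n)) \<longlonglongrightarrow> g x * (K 1 - I)"
  proof -
    have "((\<lambda>s. s * K s) has_vector_derivative deriv01 (\<lambda>s. s * K s) t) (at t within {0..1})"
      if "t \<in> {0..1}" for t
      using sK_deriv[OF that] by (simp add: sK_deriv01[OF that])
    from expectation_kernel_asymp[OF V V_nonneg this sK_cont phi_pos F \<tau> sK_int h_right]
    show ?thesis
      using kernel_if[of "\<lambda>s. s * K s"] by (simp add: D_def I_def K0)
  qed
  have phi_h: "\<forall>\<^sub>F n in sequentially. \<phi> (h n) > 0"
    by (rule eventually_compose_filterlim[OF phi_pos h_right])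
  have "\<forall>\<^sub>F n in sequentially. E n / \<phi> (h n) > 0"
    using E_lim by (rule order_tendstoD) (simp add: g_pos c_pos)
  with phi_h have E_pos: "\<forall>\<^sub>F n in sequentially. E n > 0"
    by eventually_elim (simp add: zero_less_divide_iff)
  \<comment> \<open>In the ratio both the normalisation by \<phi> and the factor \<open>g x\<close>
    cancel.\<close>
  have "(\<lambda>n. (D n / \<phi> (h n)) / (E n / \<phi> (h n))) \<longlonglongrightarrow> (g x * (K 1 - I)) / (g x * c)"
    using g_pos c_pos by (intro tendsto_divide D_lim E_lim) simp
  moreover have "\<forall>\<^sub>F n in sequentially. (D n / \<phi> (h n)) / (E n / \<phi> (h n)) = D n / E n"
    using phi_h by eventually_elim simp
  ultimately have "(\<lambda>n. D n / E n) \<longlonglongrightarrow> (g x * (K 1 - I)) / (g x * c)"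
    by (rule Lim_transform_eventually)
  then have ratio: "(\<lambda>n. D n / E n) \<longlonglongrightarrow> (K 1 - I) / c"
    using g_pos by simp

  \<comment> \<open>Stationarity and conditioning applied to the numerator\<close>
  have "\<kappa> x \<in> space (prob_algebra borel)"
    using kappa measurable_space[of \<kappa> N "prob_algebra borel" x] N_space
    by (simp add: regular_cond_distr_def)
  \<comment> \<open>\<open>psi_zero\<close> ties the value of \<psi> at 0 to the conditional law at
    \<open>x\<close>, so that the stationarity of the median becomes a statement about
    \<psi>.\<close>
  then have \<psi>0: "\<psi> 0 = 0"
    unfolding psi_zero space_prob_algebra
    by (intro L1_median_mean_sgn_eq_0 kappa_int G_diff median) auto
  have \<psi>_cont: "continuous_on UNIV \<psi>"
    using psi_diff by (intro differentiable_imp_continuous_on) (simp add: differentiable_on_def)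
  have \<psi>_deriv: "(\<psi> has_vector_derivative \<psi>') (at 0)"
    using psi_diff by (simp add: \<psi>'_def vector_derivative_works)
  have T_eq: "T n = expectation (\<lambda>\<omega>. K (V \<omega> / h n) *\<^sub>R \<psi> (V \<omega>))" for n
    unfolding T_def
  proof (rule expectation_scaleR_cond_exp_given[where k = "\<lambda>v. K (v / h n)"])
    show "cond_exp_given M V (\<lambda>\<omega>. sgn (Y \<omega> - \<mu>)) \<psi>"
      using psi unfolding V_def .
    show "integrable M (\<lambda>\<omega>. K (V \<omega> / h n) *\<^sub>R sgn (Y \<omega> - \<mu>))"
      using B order_trans[OF abs_ge_zero B]
      by (intro integrable_const_bound[where B = B]) (auto simp: norm_sgn)
    show "integrable M (\<lambda>\<omega>. K (V \<omega> / h n) *\<^sub>R \<psi> (V \<omega>))"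
      by (rule integrable_kernel_scaleR[OF V K_meas B K0 \<psi>_cont h_pos])
  qed measurable
  have "(\<lambda>n. T n /\<^sub>R (h n * E n) - (D n / E n) *\<^sub>R \<psi>') \<longlonglongrightarrow> 0"
    unfolding T_eq D_def E_def
    by (rule kernel_average_first_order[OF V K_meas K_nonneg _ K0 \<psi>_cont \<psi>0 \<psi>_deriv h_pos h_lim])
      (use B E_pos in \<open>auto simp: E_def abs_le_iff\<close>)
  from tendsto_add[OF this tendsto_scaleR[OF ratio tendsto_const[of \<psi>']]]
  have T_lim: "(\<lambda>n. T n /\<^sub>R (h n * E n)) \<longlonglongrightarrow> ((K 1 - I) / c) *\<^sub>R \<psi>'"
    by simp

  \<comment> \<open>The remainder of the bias expansion\<close>
  define bias where "bias n = cond_bias M d K (h n) Xs Ys x (\<kappa> x) n \<mu>" for n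
  \<comment> \<open>The remainder is obtained by solving the claimed identity for it. It does not
    depend on \<omega>, so it is measurable and its almost sure convergence is ordinary
    convergence.\<close>
  define \<epsilon> :: "nat \<Rightarrow> 'w \<Rightarrow> real^'n"
    where "\<epsilon> n \<omega> = - ((c / h n) *\<^sub>R bias n) - (I - K 1) *\<^sub>R (A *v \<psi>')" for n \<omega>
  \<comment> \<open>The minus signs of the gradient and of the conditional bias cancel; the factor
    \<open>h n\<close> is split off so that the rest has a finite limit.\<close>
  have bias_eq: "bias n = h n *\<^sub>R (A *v (T n /\<^sub>R (h n * E n)))" if "n \<ge> 1" for n
  proof -
    have "grad_bias M d K (h n) Xs Ys x n \<mu> = - (T n /\<^sub>R E n)"
      unfolding T_def E_def V_def
    proof (rule grad_bias_identically_distributed[OF X_rv Y_rv _ ident d_meas K_meas B that])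
      show "(\<lambda>\<omega>. (Xs i \<omega>, Ys i \<omega>)) \<in> M \<rightarrow>\<^sub>M N \<Otimes>\<^sub>M borel" if "i \<ge> 1" for i
        using indep that by (simp add: indep_vars_def2)
    qed
    then show ?thesis
      using h_pos[of n]
      by (simp add: bias_def cond_bias_def A_def matrix_vector_mult_scaleR
          linear_neg[OF matrix_vector_mul_linear])
  qed
  have "(\<lambda>n. - (c *\<^sub>R (A *v (T n /\<^sub>R (h n * E n)))) - (I - K 1) *\<^sub>R (A *v \<psi>'))
      \<longlonglongrightarrow> - (c *\<^sub>R (A *v (((K 1 - I) / c) *\<^sub>R \<psi>'))) - (I - K 1) *\<^sub>R (A *v \<psi>')"
    by (intro tendsto_intros bounded_linear.tendsto[OF matrix_vector_mul_bounded_linear] T_lim)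
  \<comment> \<open>Here the overall minus sign of the expansion is what makes the leading terms
    cancel: \<open>- (K 1 - I)\<close> equals \<open>I - K 1\<close>.\<close>
  also have "- (c *\<^sub>R (A *v (((K 1 - I) / c) *\<^sub>R \<psi>'))) - (I - K 1) *\<^sub>R (A *v \<psi>') = 0"
    using c_pos by (simp add: matrix_vector_mult_scaleR) (simp add: scaleR_diff_left)
  finally have \<epsilon>_lim: "(\<lambda>n. \<epsilon> n \<omega>) \<longlonglongrightarrow> 0" for \<omega>
  proof (rule Lim_transform_eventually)
    show "\<forall>\<^sub>F n in sequentially.
        - (c *\<^sub>R (A *v (T n /\<^sub>R (h n * E n)))) - (I - K 1) *\<^sub>R (A *v \<psi>') = \<epsilon> n \<omega>"
      using eventually_ge_at_top[of 1]
    proof eventually_elim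
      case (elim n)
      then show ?case
        using h_pos[of n] by (simp add: \<epsilon>_def bias_eq)
    qed
  qed
  have "\<epsilon> n \<in> borel_measurable M" for n
    unfolding \<epsilon>_def[abs_def] by simp
  then have "small_o_as M \<epsilon>"
    using \<epsilon>_lim by (simp add: small_o_as_def)
  \<comment> \<open>The identity is pure algebra and holds for every \<open>n\<close>; the analytic
    content is the convergence of \<epsilon> to 0.\<close>
  moreover have "bias n = - ((h n / c) *\<^sub>R ((I - K 1) *\<^sub>R (A *v \<psi>') + \<epsilon> n \<omega>))" for n \<omega>
    using c_pos h_pos[of n] by (simp add: \<epsilon>_def)
  ultimately show ?thesis
    unfolding bias_def c_def I_def A_def \<psi>'_def by blast
qed

end
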